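(* Let $m$ be a positive integer and $k$ a nonnegative integer. The map $\psi$ is a bijection between $J(P'(2m,2k+1))$ and $\mathcal{Q}'(m,k)$.
   Context: Poset $P'(s,k)$: let $L'(s,k)=\bigcup_{j\ge0}\{(i-\tfrac{k}{2}j, j): i\in\mathbb{Z}, jk+1\le i\le\lfloor s/2\rfloor\}$, $R'(s,k)=\bigcup_{j\ge0}\{(s+1-i+\tfrac{k}{2}(j+1), -j-1): i\in\mathbb{Z}, jk+\lceil(s+k)/2\rceil+1\le i\le s\}$, $P'(s,k)=L'\cup R'$, with the partial order generated by: within $L'$, $(a,b)$ covers $(a',b')$ iff $|a-a'|\le k/2$ and $b=b'+1$; within $R'$, $(a,b)$ covers $(a',b')$ iff $|a-a'|\le k/2$ and $b=b'-1$. $J(P'(s,k))$ is the set of order ideals (downward closed subsets) of $P'(s,k)$ containing no two elements $(a,0)$, $(a',-1)$ with $|a-a'|\le k/2$. Paths: for positive integer $K$ and real $s$, a free ballot $(s,K)$-path of height $n$ is a lattice path from $(0,0)$ to $(s,n)$ with steps $(K/2,1)$, $(K/2,-1)$, $(\ell,0)$ ($\ell$ an integer, $1\le\ell<K$), allowed to go below the $x$-axis; $\mathcal{FB}'_n(s,K)$ is the set of those whose first step is horizontal or down. $\mathcal{Q}'(m,k)=\bigl(\bigcup_{i=0}^{k-1}\mathcal{FB}'_0(m-i,2k+1)\bigr)\cup\mathcal{FB}'_{-1}(m+\tfrac12,2k+1)$. The map $\psi$: a point $(x,y)$ is visible if either $y$ is an even integer and $x\in\mathbb{Z}$, or $y$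 is an odd integer and $x\in\mathbb{Z}+\tfrac12$. For $I\in J(P'(2m,2k+1))$ color each visible point $(a,b)$ with $0\le a\le m+\tfrac12$: if $b\ge0$ it is black iff $(a,b)\in I$; if $b<0$ it is black iff $(a,b)\notin I$; all other points count as not black. Set $P_0=(0,0)$ and, given $P_{i-1}=(a,b)$: (Case 1) if some $(a+\ell,b)$ with $\ell$ an integer, $1\le\ell\le 2k$, is black, set $P_i=(a+k+\tfrac12,b+1)$ if that point is black, and otherwise $P_i=(a+\ell,b)$ for the smallest such $\ell$; (Case 2) if no such black point exists, set $P_i=(a+k+\tfrac12,b-1)$ if that point is black, and otherwise stop with $n=i-1$. Then $\psi(I)$ is the path with successive points $P_0,\ldots,P_n$.
   Formalization: The case k = 0 is excluded (k is taken positive): for k = 0 Case 1 of ψ never applies, so ψ(I) has only down steps, while every path in Q'(m,0) has m up steps, and the claim fails for every positive m. *)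

theory Defs
  imports Complex_Main
begin

type_synonym point = "real \<times> int"

section \<open>The poset and its ideals\<close>

definition poset_L :: "nat \<Rightarrow> nat \<Rightarrow> point set" where
  "poset_L s k = (\<Union>j::nat. {(of_int i - real k / 2 * real j, int j) | i::int.
     int j * int k + 1 \<le> i \<and> i \<le> \<lfloor>real s / 2\<rfloor>})"

definition poset_R :: "nat \<Rightarrow> nat \<Rightarrow> point set" where
  "poset_R s k = (\<Union>j::nat. {(real s + 1 - of_int i + real k / 2 * (real j + 1), - int j - 1) | i::int.
     int j * int k + \<lceil>(real s + real k) / 2\<rceil> + 1 \<le> i \<and> i \<le> int s})"

definition poset_P :: "nat \<Rightarrow> nat \<Rightarrow> point set" where
  "poset_P s k = poset_L s k \<union> poset_R s k"

text \<open>\<open>covers s k p q\<close> reads: \<open>p\<close> covers \<open>q\<close>.\<close>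

definition covers :: "nat \<Rightarrow> nat \<Rightarrow> point \<Rightarrow> point \<Rightarrow> bool" where
  "covers s k p q \<longleftrightarrow>
     p \<in> poset_L s k \<and> q \<in> poset_L s k \<and> \<bar>fst p - fst q\<bar> \<le> real k / 2 \<and> snd p = snd q + 1 \<or>
     p \<in> poset_R s k \<and> q \<in> poset_R s k \<and> \<bar>fst p - fst q\<bar> \<le> real k / 2 \<and> snd p = snd q - 1"

definition poset_le :: "nat \<Rightarrow> nat \<Rightarrow> point \<Rightarrow> point \<Rightarrow> bool" where
  "poset_le s k = (\<lambda>q p. covers s k p q)\<^sup>*\<^sup>*"

definition order_ideal :: "nat \<Rightarrow> nat \<Rightarrow> point set \<Rightarrow> bool" where
  "order_ideal s k I \<longleftrightarrow>
     I \<subseteq> poset_P s k \<and> (\<forall>p\<in>I. \<forall>q\<in>poset_P s k. poset_le s k q p \<longrightarrow> q \<in> I)"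

definition J :: "nat \<Rightarrow> nat \<Rightarrow> point set set" where
  "J s k = {I. order_ideal s k I \<and>
     \<not> (\<exists>a a'. (a, 0) \<in> I \<and> (a', -1) \<in> I \<and> \<bar>a - a'\<bar> \<le> real k / 2)}"

section \<open>Free ballot paths\<close>

text \<open>A path is the nonempty list of its successive points; a path without steps is a
  singleton list.\<close>

definition ballot_step :: "nat \<Rightarrow> point \<Rightarrow> point \<Rightarrow> bool" where
  "ballot_step K p q \<longleftrightarrow>
     q = (fst p + real K / 2, snd p + 1) \<or>
     q = (fst p + real K / 2, snd p - 1) \<or>
     (\<exists>l::nat. 1 \<le> l \<and> l < K \<and> q = (fst p + real l, snd p))"

definition free_ballot :: "int \<Rightarrow> real \<Rightarrow> nat \<Rightarrow> point list set" where
  "free_ballot n s K =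
     {ps. ps \<noteq> [] \<and> hd ps = (0, 0) \<and> last ps = (s, n) \<and> successively (ballot_step K) ps}"

text \<open>The path without steps has no first step and satisfies the restriction vacuously.\<close>

definition free_ballot' :: "int \<Rightarrow> real \<Rightarrow> nat \<Rightarrow> point list set" where
  "free_ballot' n s K =
     {ps \<in> free_ballot n s K. length ps \<ge> 2 \<longrightarrow>
       snd (ps ! 1) = snd (ps ! 0) \<or> snd (ps ! 1) = snd (ps ! 0) - 1}"

definition Q' :: "nat \<Rightarrow> nat \<Rightarrow> point list set" where
  "Q' m k = (\<Union>i\<in>{..<k}. free_ballot' 0 (real m - real i) (2 * k + 1))
            \<union> free_ballot' (-1) (real m + 1/2) (2 * k + 1)"

section \<open>The map\<close>

definition visible :: "point \<Rightarrow> bool" where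
  "visible p \<longleftrightarrow> even (snd p) \<and> fst p \<in> \<int> \<or> odd (snd p) \<and> fst p - 1/2 \<in> \<int>"

definition black :: "nat \<Rightarrow> point set \<Rightarrow> point \<Rightarrow> bool" where
  "black m I p \<longleftrightarrow> visible p \<and> 0 \<le> fst p \<and> fst p \<le> real m + 1/2 \<and>
     (if snd p \<ge> 0 then p \<in> I else p \<notin> I)"

fun psi_next :: "nat \<Rightarrow> nat \<Rightarrow> point set \<Rightarrow> point \<Rightarrow> point option" where
  "psi_next m k I (a, b) =
    (if \<exists>l::nat. 1 \<le> l \<and> l \<le> 2 * k \<and> black m I (a + real l, b)
     then (if black m I (a + real k + 1/2, b + 1)
           then Some (a + real k + 1/2, b + 1)
           else Some (a + real (LEAST l::nat. 1 \<le> l \<and> l \<le> 2 * k \<and> black m I (a + real l, b)), b))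
     else (if black m I (a + real k + 1/2, b - 1)
           then Some (a + real k + 1/2, b - 1)
           else None))"

lemma psi_next_Some:
  assumes "psi_next m k I p = Some q"
  shows "fst q \<ge> fst p + 1/2" and "fst q \<le> real m + 1/2"
proof -
  obtain a b where p: "p = (a, b)" by (cases p)
  define B where "B = (\<lambda>l::nat. 1 \<le> l \<and> l \<le> 2 * k \<and> black m I (a + real l, b))"
  define l0 where "l0 = (LEAST l. B l)"
  have q: "Some q = (if \<exists>l. B l
     then (if black m I (a + real k + 1/2, b + 1) then Some (a + real k + 1/2, b + 1)
           else Some (a + real l0, b))
     else (if black m I (a + real k + 1/2, b - 1) then Some (a + real k + 1/2, b - 1) else None))"
    using assms unfolding p psi_next.simps B_def l0_def by simp
  have "fst q \<ge> fst p + 1/2 \<and> black m I q"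
  proof (cases "\<exists>l. B l")
    case True
    then have "B l0" unfolding l0_def by (rule LeastI_ex)
    then have "1 \<le> real l0" "black m I (a + real l0, b)" by (simp_all add: B_def)
    with q True show ?thesis by (auto simp: p split: if_splits)
  next
    case False
    with q show ?thesis by (auto simp: p split: if_splits)
  qed
  then have "fst q \<ge> fst p + 1/2 \<and> fst q \<le> real m + 1/2"
    by (simp add: black_def)
  then show "fst q \<ge> fst p + 1/2" and "fst q \<le> real m + 1/2" by auto
qed

function psi_from :: "nat \<Rightarrow> nat \<Rightarrow> point set \<Rightarrow> point \<Rightarrow> point list" where
  "psi_from m k I p =
     p # (case psi_next m k I p of None \<Rightarrow> [] | Some q \<Rightarrow> psi_from m k I q)"
  by auto
termination
proof (relation "measure (\<lambda>(m, k, I, p). nat \<lceil>2 * (real m + 1/2 - fst p)\<rceil>)", goal_cases)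
  case 1
  show ?case by simp
next
  case (2 m k I p q)
  then have "fst q \<ge> fst p + 1/2" "fst q \<le> real m + 1/2"
    using psi_next_Some by blast+
  then have "2 * (real m + 1/2 - fst q) + 1 \<le> 2 * (real m + 1/2 - fst p)"
    and "0 \<le> 2 * (real m + 1/2 - fst q)"
    by auto
  then have "\<lceil>2 * (real m + 1/2 - fst q)\<rceil> < \<lceil>2 * (real m + 1/2 - fst p)\<rceil>"
    and "0 < \<lceil>2 * (real m + 1/2 - fst p)\<rceil>"
    by linarith+
  then show ?case by simp
qed

declare psi_from.simps [simp del]

definition psi :: "nat \<Rightarrow> nat \<Rightarrow> point set \<Rightarrow> point list" where
  "psi m k I = psi_from m k I (0, 0)"

section \<open>The degenerate case\<close>

text \<open>For \<open>k = 0\<close> there are no horizontal steps, so the first case in the definition of the map never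
  applies and the map produces only down steps, whereas the paths in \<open>Q' m 0\<close> contain up steps.
  Hence it is not a bijection for any positive \<open>m\<close>.\<close>

lemma psi_from_0_slope:
  assumes "q \<in> set (psi_from m 0 I p)" and "of_int (snd p) = - 2 * fst p"
  shows "of_int (snd q) = - 2 * fst q"
  using assms
proof (induction m "0::nat" I p rule: psi_from.induct)
  case (1 m I p)
  obtain a b where p: "p = (a, b)" by (cases p)
  show ?case
  proof (cases "psi_next m 0 I p")
    case None
    with 1 show ?thesis by (simp add: psi_from.simps[of m 0 I p])
  next
    case (Some r)
    then have "r = (a + 1/2, b - 1)" by (auto simp: p split: if_splits)
    then have "of_int (snd r) = - 2 * fst r" using 1(3) by (simp add: p)
    with 1 Some show ?thesis by (auto simp: psi_from.simps[of m 0 I p])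
  qed
qed

lemma psi_0_not_bij:
  assumes "m > 0"
  shows "\<not> bij_betw (psi m 0) (J (2 * m) (2 * 0 + 1)) (Q' m 0)"
proof
  assume "bij_betw (psi m 0) (J (2 * m) (2 * 0 + 1)) (Q' m 0)"
  moreover have "{} \<in> J (2 * m) (2 * 0 + 1)" by (simp add: J_def order_ideal_def)
  ultimately have "psi m 0 {} \<in> Q' m 0" by (meson bij_betwE)
  then have l: "last (psi m 0 {}) = (real m + 1/2, -1)" "psi m 0 {} \<noteq> []"
    by (auto simp: Q'_def free_ballot'_def free_ballot_def)
  then have "(real m + 1/2, -1) \<in> set (psi m 0 {})" using last_in_set by metis
  then have "of_int (-1) = - 2 * (real m + 1/2)"
    using psi_from_0_slope[of "(real m + 1/2, -1)" m "{}" "(0, 0)"] by (simp add: psi_def)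
  with assms show False by simp
qed

end

theory Submission
  imports Defs
begin

text \<open>In the coordinates \<open>u = x + b (k + 1/2)\<close> and \<open>v = x - b (k + 1/2)\<close> of a point \<open>(x, b)\<close>,
  a ballot path is weakly increasing in both coordinates, and \<open>below\<close>
  (smaller \<open>u\<close>, larger \<open>v\<close>) generates the coverings of both halves of the poset, the one of
  \<open>R'\<close> reversed. An order ideal in \<open>J\<close> is thus the same as a black region closed under \<open>below\<close> that
  contains all of the lower half plane outside \<open>R'\<close> and avoids all of the upper one outside \<open>L'\<close>.
  The map \<open>psi\<close> traces the upper boundary of this region: the region is recovered
  as the set of visible points of the strip below some point of the path (except the origin), and
  every path in \<open>Q'\<close> is the boundary of the region defined from it in this way.\<close>

section \<open>Diagonal coordinates\<close>

definition ucoord :: "nat \<Rightarrow> point \<Rightarrow> real" where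
  "ucoord k p = fst p + of_int (snd p) * (real k + 1/2)"

definition vcoord :: "nat \<Rightarrow> point \<Rightarrow> real" where
  "vcoord k p = fst p - of_int (snd p) * (real k + 1/2)"

definition below :: "nat \<Rightarrow> point \<Rightarrow> point \<Rightarrow> bool" where
  "below k q p \<longleftrightarrow> ucoord k q \<le> ucoord k p \<and> vcoord k p \<le> vcoord k q"

definition up :: "nat \<Rightarrow> point \<Rightarrow> point" where
  "up k p = (fst p + real k + 1/2, snd p + 1)"

definition down :: "nat \<Rightarrow> point \<Rightarrow> point" where
  "down k p = (fst p + real k + 1/2, snd p - 1)"

definition right :: "nat \<Rightarrow> point \<Rightarrow> point" where
  "right l p = (fst p + real l, snd p)"

lemma coord_simps [simp]:
  "ucoord k (up k p) = ucoord k p + (2 * real k + 1)"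
  "vcoord k (up k p) = vcoord k p"
  "ucoord k (down k p) = ucoord k p"
  "vcoord k (down k p) = vcoord k p + (2 * real k + 1)"
  "ucoord k (right l p) = ucoord k p + real l"
  "vcoord k (right l p) = vcoord k p + real l"
  "ucoord k (0, 0) = 0"
  "vcoord k (0, 0) = 0"
  by (simp_all add: ucoord_def vcoord_def up_def down_def right_def field_simps)

lemma snd_simps [simp]:
  "snd (up k p) = snd p + 1" "snd (down k p) = snd p - 1" "snd (right l p) = snd p"
  by (simp_all add: up_def down_def right_def)

lemma coord_diff: "ucoord k p - vcoord k p = of_int (snd p) * (2 * real k + 1)"
  by (simp add: ucoord_def vcoord_def algebra_simps)

lemma fst_eq_coords: "fst p = (ucoord k p + vcoord k p) / 2"
  by (simp add: ucoord_def vcoord_def)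

text \<open>The shift by \<open>snd p * (k + 1/2)\<close> is an integer in even rows and a half-odd
  integer in odd rows, so both parity cases become integrality of the single coordinate
  \<open>u\<close>.\<close>

lemma visible_iff: "visible p \<longleftrightarrow> ucoord k p \<in> \<int>"
proof (cases "even (snd p)")
  case True
  then obtain c where c: "snd p = 2 * c" by (elim evenE)
  have "ucoord k p = fst p + of_int (c * (2 * int k + 1))"
    by (simp add: ucoord_def c algebra_simps)
  then show ?thesis
    using True
    by (smt (verit) visible_def Ints_of_int Ints_add Ints_diff)
next
  case False
  then obtain c where c: "snd p = 2 * c + 1" by (elim oddE)
  have "ucoord k p = (fst p - 1/2) + of_int (c * (2 * int k + 1) + int k + 1)"
    by (simp add: ucoord_def c algebra_simps)
  then show ?thesis
    using False
    by (smt (verit) visible_def Ints_of_int Ints_add Ints_diff)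
qed

text \<open>With \<open>u\<close> and \<open>v\<close> integers congruent modulo
  \<open>2 * k + 1\<close>, strict inequalities between coordinates gain a unit.\<close>

lemma visible_coords:
  assumes "visible p"
  obtains u v where "ucoord k p = of_int u" "vcoord k p = of_int v"
    "u - v = snd p * (2 * int k + 1)"
proof -
  obtain u where u: "ucoord k p = of_int u"
    using assms visible_iff Ints_cases by metis
  have "vcoord k p = of_int (u - snd p * (2 * int k + 1))"
    using coord_diff[of k p] u by simp
  with u that show ?thesis by (metis add_diff_cancel_left' diff_add_cancel)
qed

lemma visible_steps [simp]:
  "visible (up k p) \<longleftrightarrow> visible p" "visible (down k p) \<longleftrightarrow> visible p"
  "visible (right l p) \<longleftrightarrow> visible p"
proof -
  have e: "2 * real k + 1 \<in> \<int>" "real l \<in> \<int>"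
    by (auto intro: Ints_add Ints_mult)
  have *: "x + y \<in> \<int> \<longleftrightarrow> x \<in> \<int>" if "y \<in> \<int>" for x y :: real
    using that by (metis Ints_add Ints_diff add_diff_cancel_right')
  show "visible (up k p) \<longleftrightarrow> visible p" "visible (down k p) \<longleftrightarrow> visible p"
    "visible (right l p) \<longleftrightarrow> visible p"
    by (simp_all add: visible_iff[of _ k] *[OF e(1)] *[OF e(2)])
qed

lemma visible_origin: "visible (0, 0)"
  by (simp add: visible_def)

lemma coord_diff_nonneg: "0 \<le> snd p \<Longrightarrow> vcoord k p \<le> ucoord k p"
  using coord_diff[of k p] by (smt (verit) of_int_0_le_iff mult_nonneg_nonneg of_nat_0_le_iff)

lemma coord_diff_ge:
  assumes "c \<le> snd p"
  shows "of_int c * (2 * real k + 1) \<le> ucoord k p - vcoord k p"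
  unfolding coord_diff by (rule mult_right_mono) (use assms in auto)

lemma coord_diff_le:
  assumes "snd p \<le> c"
  shows "ucoord k p - vcoord k p \<le> of_int c * (2 * real k + 1)"
  unfolding coord_diff by (rule mult_right_mono) (use assms in auto)

lemma below_refl: "below k p p"
  by (simp add: below_def)

lemma below_trans: "below k p q \<Longrightarrow> below k q r \<Longrightarrow> below k p r"
  by (auto simp: below_def)

text \<open>Going \<open>below\<close> cannot increase \<open>u - v\<close>, which is the row times
  \<open>2 * k + 1\<close>.\<close>

lemma below_snd_le:
  assumes "below k q p"
  shows "snd q \<le> snd p"
proof (rule ccontr)
  assume "\<not> snd q \<le> snd p"
  then have "snd p + 1 \<le> snd q" by simp
  from coord_diff_ge[OF this, of k] coord_diff[of k p] assms show False
    by (simp add: below_def algebra_simps)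
qed

lemma below_same_row:
  assumes "below k q p" "snd q = snd p"
  shows "q = p"
proof -
  have "fst q = fst p"
    using assms by (auto simp: below_def ucoord_def vcoord_def)
  with assms(2) show ?thesis by (simp add: prod_eq_iff)
qed

text \<open>Between adjacent rows the two inequalities of \<open>below\<close> are the two halves of
  the absolute value bound in \<open>covers\<close>.\<close>

lemma near_iff_below:
  assumes "snd q = snd p - 1"
  shows "\<bar>fst p - fst q\<bar> \<le> real (2 * k + 1) / 2 \<longleftrightarrow> below k q p"
  by (auto simp: below_def ucoord_def vcoord_def assms abs_if field_simps split: if_splits)

lemma ballot_step_iff:
  "ballot_step (2 * k + 1) p q \<longleftrightarrow>
     q = up k p \<or> q = down k p \<or> (\<exists>l. 1 \<le> l \<and> l \<le> 2 * k \<and> q = right l p)"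
proof -
  have "fst p + real (2 * k + 1) / 2 = fst p + real k + 1/2"
    by (simp add: field_simps)
  then show ?thesis
    unfolding ballot_step_def up_def down_def right_def by (auto simp: less_Suc_eq_le)
qed

section \<open>Ideals as regions below a path\<close>

text \<open>The index \<open>i\<close> of the definition is \<open>u\<close>, and
  \<open>i - j * (2 * k + 1)\<close> is \<open>v\<close>, so its two bounds separate into one for
  each coordinate.\<close>

lemma mem_poset_L:
  "p \<in> poset_L (2 * m) (2 * k + 1) \<longleftrightarrow>
     visible p \<and> 0 \<le> snd p \<and> 1 \<le> vcoord k p \<and> ucoord k p \<le> real m"
proof
  assume "p \<in> poset_L (2 * m) (2 * k + 1)"
  then obtain j :: nat and i :: int where
    p: "p = (of_int i - real (2 * k + 1) / 2 * real j, int j)"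
    and i: "int j * int (2 * k + 1) + 1 \<le> i" "i \<le> \<lfloor>real (2 * m) / 2\<rfloor>"
    unfolding poset_L_def by auto
  have u: "ucoord k p = of_int i"
    by (simp add: p ucoord_def algebra_simps add_divide_distrib)
  have v: "vcoord k p = of_int (i - int j * int (2 * k + 1))"
    using coord_diff[of k p] u by (simp add: p algebra_simps)
  have "1 \<le> i - int j * int (2 * k + 1)" using i by linarith
  then have "1 \<le> vcoord k p" unfolding v by linarith
  moreover have "ucoord k p \<le> real m" unfolding u using i(2) by simp
  moreover have "visible p" unfolding visible_iff[of _ k] u by simp
  ultimately show "visible p \<and> 0 \<le> snd p \<and> 1 \<le> vcoord k p \<and> ucoord k p \<le> real m"
    by (simp add: p)
next
  assume p: "visible p \<and> 0 \<le> snd p \<and> 1 \<le> vcoord k p \<and> ucoord k p \<le> real m"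
  then obtain u v where uv: "ucoord k p = of_int u" "vcoord k p = of_int v"
    "u - v = snd p * (2 * int k + 1)"
    using visible_coords by blast
  obtain j where j: "snd p = int j" using p nonneg_int_cases by blast
  have "1 \<le> v" "u \<le> int m" using p uv by auto
  then have "int j * int (2 * k + 1) + 1 \<le> u" "u \<le> \<lfloor>real (2 * m) / 2\<rfloor>"
    using uv(3) j by (auto simp: algebra_simps)
  moreover have "p = (of_int u - real (2 * k + 1) / 2 * real j, int j)"
    using uv(1) j by (simp add: prod_eq_iff ucoord_def algebra_simps add_divide_distrib)
  ultimately show "p \<in> poset_L (2 * m) (2 * k + 1)"
    unfolding poset_L_def by blast
qed

text \<open>Here \<open>i = 2 * m + 1 - u\<close>. The upper bound on \<open>i\<close> thus becomes
  \<open>u \<ge> 1\<close>, and in row \<open>- j - 1\<close> the lower bound becomes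
  \<open>v \<le> m + k\<close>.\<close>

lemma mem_poset_R:
  "p \<in> poset_R (2 * m) (2 * k + 1) \<longleftrightarrow>
     visible p \<and> snd p < 0 \<and> 1 \<le> ucoord k p \<and> vcoord k p \<le> real m + real k"
proof -
  have c: "\<lceil>(real (2 * m) + real (2 * k + 1)) / 2\<rceil> = int m + int k + 1"
    by (simp add: ceiling_eq_iff field_simps)
  show ?thesis
  proof
    assume "p \<in> poset_R (2 * m) (2 * k + 1)"
    then obtain j :: nat and i :: int where
      p: "p = (real (2 * m) + 1 - of_int i + real (2 * k + 1) / 2 * (real j + 1), - int j - 1)"
      and i: "int j * int (2 * k + 1) + (int m + int k + 1) + 1 \<le> i" "i \<le> int (2 * m)"
      unfolding poset_R_def c by auto
    have u: "ucoord k p = of_int (2 * int m + 1 - i)"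
      by (simp add: p ucoord_def field_simps)
    have v: "vcoord k p = of_int (2 * int m + 1 - i + (int j + 1) * (2 * int k + 1))"
      using coord_diff[of k p] u by (simp add: p algebra_simps)
    have "2 * int m + 1 - i + (int j + 1) * (2 * int k + 1) \<le> int m + int k"
      using i(1) by (simp add: algebra_simps)
    then have "vcoord k p \<le> of_int (int m + int k)" unfolding v of_int_le_iff .
    moreover have "1 \<le> ucoord k p" unfolding u using i(2) by linarith
    moreover have "visible p" unfolding visible_iff[of _ k] u by (rule Ints_of_int)
    ultimately show "visible p \<and> snd p < 0 \<and> 1 \<le> ucoord k p \<and> vcoord k p \<le> real m + real k"
      by (simp add: p)
  next
    assume p: "visible p \<and> snd p < 0 \<and> 1 \<le> ucoord k p \<and> vcoord k p \<le> real m + real k"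
    then obtain u v where uv: "ucoord k p = of_int u" "vcoord k p = of_int v"
      "u - v = snd p * (2 * int k + 1)"
      using visible_coords by blast
    obtain j where j: "snd p = - int j - 1"
      using p by (metis add.commute diff_minus_eq_add minus_diff_eq negD of_nat_Suc uminus_add_conv_diff)
    have "1 \<le> u" "v \<le> int m + int k" using p uv by linarith+
    define i where "i = 2 * int m + 1 - u"
    have "int j * int (2 * k + 1) + (int m + int k + 1) + 1 \<le> i" "i \<le> int (2 * m)"
      using uv(3) j \<open>1 \<le> u\<close> \<open>v \<le> int m + int k\<close> by (simp_all add: i_def algebra_simps)
    moreover have "p = (real (2 * m) + 1 - of_int i + real (2 * k + 1) / 2 * (real j + 1), - int j - 1)"
      using uv(1) j
      by (simp add: prod_eq_iff ucoord_def i_def field_simps)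
    ultimately show "p \<in> poset_R (2 * m) (2 * k + 1)"
      unfolding poset_R_def c by blast
  qed
qed

text \<open>Blackness without the strip condition: points \<open>below\<close> a point of the strip
  may leave the strip, so only the unrestricted region is closed.\<close>

definition dark :: "point set \<Rightarrow> point \<Rightarrow> bool" where
  "dark I p \<longleftrightarrow> visible p \<and> (if 0 \<le> snd p then p \<in> I else p \<notin> I)"

lemma black_iff_dark: "black m I p \<longleftrightarrow> dark I p \<and> 0 \<le> fst p \<and> fst p \<le> real m + 1/2"
  by (auto simp: black_def dark_def)

lemma covers_iff_below:
  "covers (2 * m) (2 * k + 1) p q \<longleftrightarrow>
     p \<in> poset_L (2 * m) (2 * k + 1) \<and> q \<in> poset_L (2 * m) (2 * k + 1) \<and>
       below k q p \<and> snd p = snd q + 1 \<or>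
     p \<in> poset_R (2 * m) (2 * k + 1) \<and> q \<in> poset_R (2 * m) (2 * k + 1) \<and>
       below k p q \<and> snd p = snd q - 1"
  using near_iff_below[of q p k] near_iff_below[of p q k]
  unfolding covers_def by (auto simp: abs_minus_commute)

lemma poset_L_nonneg: "p \<in> poset_L s k \<Longrightarrow> 0 \<le> snd p"
  by (auto simp: poset_L_def)

lemma poset_R_neg: "p \<in> poset_R s k \<Longrightarrow> snd p < 0"
  by (auto simp: poset_R_def)

lemma poset_P_nonneg: "p \<in> poset_P s k \<Longrightarrow> 0 \<le> snd p \<Longrightarrow> p \<in> poset_L s k"
  unfolding poset_P_def using poset_R_neg by fastforce

lemma poset_P_neg: "p \<in> poset_P s k \<Longrightarrow> snd p < 0 \<Longrightarrow> p \<in> poset_R s k"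
  unfolding poset_P_def using poset_L_nonneg by fastforce

lemma poset_P_visible: "p \<in> poset_P (2 * m) (2 * k + 1) \<Longrightarrow> visible p"
  unfolding poset_P_def Un_iff mem_poset_L mem_poset_R by blast

text \<open>The order of \<open>R'\<close> is reversed when passing from an ideal to its complement, and the
  condition that separates rows 0 and -1 is the remaining instance of closure under \<open>below\<close>.\<close>

lemma J_iff_dark_closed:
  "I \<in> J (2 * m) (2 * k + 1) \<longleftrightarrow>
     I \<subseteq> poset_P (2 * m) (2 * k + 1) \<and>
     (\<forall>p q. dark I p \<longrightarrow> visible q \<longrightarrow> below k q p \<longrightarrow> snd q = snd p - 1 \<longrightarrow> dark I q)"
  (is "_ \<longleftrightarrow> _ \<and> ?closed")
proof
  assume I: "I \<in> J (2 * m) (2 * k + 1)"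
  then have sub: "I \<subseteq> poset_P (2 * m) (2 * k + 1)"
    by (simp only: J_def order_ideal_def mem_Collect_eq)
  have ideal: "q \<in> I" if "p \<in> I" "q \<in> poset_P (2 * m) (2 * k + 1)"
    "covers (2 * m) (2 * k + 1) p q" for p q
  proof -
    have "poset_le (2 * m) (2 * k + 1) q p"
      unfolding poset_le_def
      using r_into_rtranclp[of "\<lambda>q p. covers (2 * m) (2 * k + 1) p q" q p] that(3) by blast
    with I that show ?thesis unfolding J_def order_ideal_def by blast
  qed
  have sep: False if "(a, 0) \<in> I" "(a', -1) \<in> I" "\<bar>a - a'\<bar> \<le> real (2 * k + 1) / 2" for a a'
    using I that unfolding J_def by blast
  have "dark I q" if p: "dark I p" and q: "visible q" "below k q p" "snd q = snd p - 1" for p q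
  proof -
    consider "1 \<le> snd p" | "snd p = 0" | "snd p < 0" by linarith
    then show ?thesis
    proof cases
      case 1
      with p have "p \<in> I" by (auto simp: dark_def)
      then have pL: "p \<in> poset_L (2 * m) (2 * k + 1)"
        using poset_P_nonneg[OF subsetD[OF sub]] 1 by simp
      have "ucoord k q - vcoord k q = ucoord k p - vcoord k p - (2 * real k + 1)"
        unfolding coord_diff q(3) by (simp add: algebra_simps)
      \<comment> \<open>The bounds \<open>v \<ge> 1\<close> and \<open>u \<le> m\<close> both
        survive going \<open>below\<close>.\<close>
      then have "q \<in> poset_L (2 * m) (2 * k + 1)"
        using pL q 1 unfolding mem_poset_L below_def by auto
      moreover have "snd p = snd q + 1" using q(3) by simp
      ultimately have "covers (2 * m) (2 * k + 1) p q" "q \<in> poset_P (2 * m) (2 * k + 1)"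
        using pL q(2) unfolding covers_iff_below poset_P_def by blast+
      then have "q \<in> I" using ideal \<open>p \<in> I\<close> by blast
      with q 1 show ?thesis by (simp add: dark_def)
    next
      case 2
      then have "p \<in> I" using p by (simp add: dark_def)
      have "\<bar>fst p - fst q\<bar> \<le> real (2 * k + 1) / 2"
        using near_iff_below[of q p k] q by blast
      then have "q \<notin> I"
        using sep[of "fst p" "fst q"] \<open>p \<in> I\<close> 2 q(3) by (metis diff_0 prod.collapse)
      with q 2 show ?thesis by (simp add: dark_def)
    next
      case 3
      \<comment> \<open>In negative rows membership means not dark, so the ideal property acts
        upwards: from \<open>q\<close> in \<open>I\<close> it would put \<open>p\<close> into
        \<open>I\<close>, as \<open>q\<close> covers \<open>p\<close> in
        \<open>poset_R\<close>.\<close>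
      have "q \<notin> I"
      proof
        assume "q \<in> I"
        moreover have "snd q < 0" using 3 q by simp
        ultimately have qR: "q \<in> poset_R (2 * m) (2 * k + 1)"
          using poset_P_neg[OF subsetD[OF sub]] by simp
        have "ucoord k q - vcoord k q = ucoord k p - vcoord k p - (2 * real k + 1)"
          unfolding coord_diff q(3) by (simp add: algebra_simps)
        then have "p \<in> poset_R (2 * m) (2 * k + 1)"
          using qR q 3 p unfolding mem_poset_R below_def dark_def by auto
        then have "covers (2 * m) (2 * k + 1) q p" "p \<in> poset_P (2 * m) (2 * k + 1)"
          using qR q(2,3) unfolding covers_iff_below poset_P_def by blast+
        then have "p \<in> I" using ideal \<open>q \<in> I\<close> by blast
        with p 3 show False by (simp add: dark_def)
      qed
      with q 3 show ?thesis by (simp add: dark_def)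
    qed
  qed
  with sub show "I \<subseteq> poset_P (2 * m) (2 * k + 1) \<and> ?closed" by blast
next
  assume I: "I \<subseteq> poset_P (2 * m) (2 * k + 1) \<and> ?closed"
  then have closed: "\<And>p q. dark I p \<Longrightarrow> visible q \<Longrightarrow> below k q p \<Longrightarrow> snd q = snd p - 1 \<Longrightarrow> dark I q"
    by blast
  have step_closed: "q \<in> I" if "p \<in> I" "covers (2 * m) (2 * k + 1) p q" for p q
  proof -
    from that(2) consider
      (L) "p \<in> poset_L (2 * m) (2 * k + 1)" "q \<in> poset_L (2 * m) (2 * k + 1)"
        "below k q p" "snd p = snd q + 1"
    | (R) "p \<in> poset_R (2 * m) (2 * k + 1)" "q \<in> poset_R (2 * m) (2 * k + 1)"
        "below k p q" "snd p = snd q - 1"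
      unfolding covers_iff_below by blast
    then show ?thesis
    proof cases
      case L
      then have *: "visible p" "visible q" "0 \<le> snd p" "0 \<le> snd q" unfolding mem_poset_L by blast+
      then have "dark I p" using that(1) by (simp add: dark_def)
      moreover have "snd q = snd p - 1" using L(4) by linarith
      ultimately have "dark I q" using closed * L(3) by blast
      with * show ?thesis by (simp add: dark_def)
    next
      case R
      then have *: "visible p" "visible q" "snd p < 0" "snd q < 0" unfolding mem_poset_R by blast+
      then have "\<not> dark I p" using that(1) by (simp add: dark_def)
      then have "\<not> dark I q" using closed * R(3,4) by blast
      with * show ?thesis by (simp add: dark_def)
    qed
  qed
  have "q \<in> I" if "poset_le (2 * m) (2 * k + 1) q p" "p \<in> I" for p q
    using that unfolding poset_le_def
  proof (induction rule: converse_rtranclp_induct)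
    case base
    then show ?case by simp
  next
    case (step y z)
    then show ?case using step_closed[of z y] by simp
  qed
  then have "order_ideal (2 * m) (2 * k + 1) I"
    using I unfolding order_ideal_def by blast
  moreover have False if "(a, 0) \<in> I" "(a', -1) \<in> I" "\<bar>a - a'\<bar> \<le> real (2 * k + 1) / 2" for a a'
  proof -
    have "below k (a', -1) (a, 0)"
      using near_iff_below[of "(a', -1)" "(a, 0)" k] that(3) by simp
    moreover have "visible (a, 0)" "visible (a', -1)"
      using I that poset_P_visible by blast+
    ultimately show False
      using closed[of "(a, 0)" "(a', -1)"] that by (simp add: dark_def)
  qed
  ultimately show "I \<in> J (2 * m) (2 * k + 1)" unfolding J_def by blast
qed

text \<open>Closure between adjacent rows is iterated by induction on the difference of rows,
  through a point \<open>r\<close> one row under \<open>p\<close> that still has \<open>q\<close>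
  \<open>below\<close> it.\<close>

lemma dark_below:
  assumes "I \<in> J (2 * m) (2 * k + 1)" "dark I p" "visible q" "below k q p"
  shows "dark I q"
  using assms(2-)
proof (induction "nat (snd p - snd q)" arbitrary: p)
  case 0
  then have "snd q = snd p" using below_snd_le by fastforce
  with 0 below_same_row show ?case by metis
next
  case (Suc d)
  then have lt: "snd q \<le> snd p - 1" by linarith
  \<comment> \<open>The least \<open>u\<close> in row \<open>snd p - 1\<close> with \<open>u\<close>
    at least that of \<open>q\<close> and \<open>v\<close> at least that of \<open>p\<close>; being
    least, it also keeps \<open>v\<close> at most that of \<open>q\<close>.\<close>
  define u where "u = max (ucoord k q) (ucoord k p - (2 * real k + 1))"
  define r where "r = (u - of_int (snd p - 1) * (real k + 1/2), snd p - 1)"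
  have u: "ucoord k r = u" "snd r = snd p - 1" by (simp_all add: r_def ucoord_def)
  have v: "u - vcoord k r = ucoord k p - vcoord k p - (2 * real k + 1)"
    using coord_diff[of k r] coord_diff[of k p] u by (simp add: algebra_simps)
  have "visible r"
  proof -
    have "visible (down k p)" using Suc.prems by (simp add: dark_def)
    have "u = ucoord k q \<or> u = ucoord k p - (2 * real k + 1)" by (auto simp: u_def)
    moreover have "ucoord k q \<in> \<int>" "ucoord k p \<in> \<int>"
      using Suc.prems by (auto simp: dark_def visible_iff[of _ k])
    moreover have "2 * real k + 1 \<in> \<int>" by (auto intro: Ints_add Ints_mult)
    ultimately have "u \<in> \<int>" by (auto intro: Ints_diff)
    with u show ?thesis by (simp add: visible_iff[of _ k])
  qed
  moreover have "below k r p"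
    using Suc.prems(3) v u unfolding below_def by (auto simp: u_def max_def split: if_splits)
  ultimately have "dark I r"
    using assms(1) Suc.prems(1) u(2) unfolding J_iff_dark_closed by blast
  moreover have "below k q r"
  proof -
    have "snd q \<le> snd r" using lt u by simp
    from coord_diff_le[OF this, of k] have "ucoord k q - vcoord k q \<le> u - vcoord k r"
      by (metis coord_diff u(1))
    then show ?thesis using Suc.prems(3) v u unfolding below_def by (auto simp: u_def max_def split: if_splits)
  qed
  ultimately show ?case using Suc.hyps(1)[of r] Suc.hyps(2) Suc.prems(2) u(2) lt by simp
qed

lemma J_subset: "I \<in> J s k \<Longrightarrow> I \<subseteq> poset_P s k"
  by (simp add: J_def order_ideal_def)

lemma dark_nonneg_bounds:
  assumes "I \<in> J (2 * m) (2 * k + 1)" "dark I p" "0 \<le> snd p"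
  shows "1 \<le> vcoord k p" "ucoord k p \<le> real m"
proof -
  have "p \<in> poset_L (2 * m) (2 * k + 1)"
    using poset_P_nonneg[OF subsetD[OF J_subset[OF assms(1)]]] assms(2,3) by (simp add: dark_def)
  then show "1 \<le> vcoord k p" "ucoord k p \<le> real m" unfolding mem_poset_L by simp_all
qed

lemma dark_if_outside:
  assumes "I \<in> J (2 * m) (2 * k + 1)" "visible p" "snd p < 0"
    and "ucoord k p < 1 \<or> real m + real k < vcoord k p"
  shows "dark I p"
proof -
  have "p \<notin> poset_R (2 * m) (2 * k + 1)" using assms(4) unfolding mem_poset_R by auto
  then have "p \<notin> I"
    using poset_P_neg[OF subsetD[OF J_subset[OF assms(1)]]] assms(3) by blast
  with assms show ?thesis by (simp add: dark_def)
qed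

section \<open>The path traced along an ideal\<close>

lemma psi_next_up:
  assumes "1 \<le> l" "l \<le> 2 * k" "black m I (right l p)" "black m I (up k p)"
  shows "psi_next m k I p = Some (up k p)"
  using assms by (cases p) (auto simp: up_def right_def)

lemma psi_next_right:
  assumes "1 \<le> l" "l \<le> 2 * k" "black m I (right l p)" "\<not> black m I (up k p)"
    and "\<And>j. 1 \<le> j \<Longrightarrow> j < l \<Longrightarrow> \<not> black m I (right j p)"
  shows "psi_next m k I p = Some (right l p)"
proof -
  have "(LEAST l. 1 \<le> l \<and> l \<le> 2 * k \<and> black m I (right l p)) = l"
    by (rule Least_equality) (use assms in \<open>auto simp: not_less[symmetric]\<close>)
  with assms show ?thesis by (cases p) (auto simp: up_def right_def)
qed

lemma psi_next_down:
  assumes "\<And>j. 1 \<le> j \<Longrightarrow> j \<le> 2 * k \<Longrightarrow> \<not> black m I (right j p)" "black m I (down k p)"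
  shows "psi_next m k I p = Some (down k p)"
  using assms by (cases p) (auto simp: down_def right_def)

lemma psi_next_None_iff:
  "psi_next m k I p = None \<longleftrightarrow>
     (\<forall>j. 1 \<le> j \<longrightarrow> j \<le> 2 * k \<longrightarrow> \<not> black m I (right j p)) \<and> \<not> black m I (down k p)"
  by (cases p) (auto simp: down_def right_def)

lemma psi_next_cases:
  assumes "psi_next m k I p = Some r"
  obtains (up) "r = up k p" "black m I r"
  | (right) l where "1 \<le> l" "l \<le> 2 * k" "r = right l p" "black m I r" "\<not> black m I (up k p)"
      "\<And>j. 1 \<le> j \<Longrightarrow> j < l \<Longrightarrow> \<not> black m I (right j p)"
  | (down) "r = down k p" "black m I r"
      "\<And>j. 1 \<le> j \<Longrightarrow> j \<le> 2 * k \<Longrightarrow> \<not> black m I (right j p)"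
proof (cases "\<exists>l. 1 \<le> l \<and> l \<le> 2 * k \<and> black m I (right l p)")
  case False
  then have "black m I (down k p)" using assms psi_next_None_iff[of m k I p] by auto
  with False show thesis using down assms psi_next_down[of k m I p] by auto
next
  case ex: True
  show thesis
  proof (cases "black m I (up k p)")
    case True
    with ex show thesis using up assms psi_next_up[of _ k m I p] by auto
  next
    case False
    define l where "l = (LEAST l. 1 \<le> l \<and> l \<le> 2 * k \<and> black m I (right l p))"
    have l: "1 \<le> l \<and> l \<le> 2 * k \<and> black m I (right l p)"
      unfolding l_def by (rule LeastI_ex[OF ex])
    have min: "\<not> black m I (right j p)" if "1 \<le> j" "j < l" for j
      using not_less_Least[OF that(2)[unfolded l_def]] that l by auto
    show thesis using right[of l] l min False assms psi_next_right[of l k m I p] by simp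
  qed
qed

section \<open>The invariant of the traced path\<close>

text \<open>The last conjunct says that no dark point lies above the part of the path up to \<open>p\<close>.\<close>

definition frontier :: "nat \<Rightarrow> nat \<Rightarrow> point set \<Rightarrow> point \<Rightarrow> bool" where
  "frontier m k I p \<longleftrightarrow> visible p \<and> 0 \<le> fst p \<and> fst p \<le> real m + 1/2 \<and>
     vcoord k p \<le> real m + real k + 1 \<and> (p = (0, 0) \<or> dark I p) \<and>
     (\<forall>q. dark I q \<longrightarrow> ucoord k p < ucoord k q \<longrightarrow> vcoord k p \<le> vcoord k q)"

lemma coord_diff_neg: "snd p < 0 \<Longrightarrow> ucoord k p - vcoord k p \<le> - (2 * real k + 1)"
  using coord_diff_le[of p "-1" k] by simp

lemma fst_right [simp]: "fst (right l p) = fst p + real l"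
  by (simp add: right_def)

lemma fst_up [simp]: "fst (up k p) = fst p + real k + 1/2"
  by (simp add: up_def)

lemma fst_down [simp]: "fst (down k p) = fst p + real k + 1/2"
  by (simp add: down_def)

text \<open>A dark point with \<open>u > 0\<close> has \<open>v \<ge> 1\<close> in the upper half by
  the shape of \<open>poset_L\<close>; in the lower half its \<open>v\<close> exceeds its
  \<open>u\<close>.\<close>

lemma frontier_origin:
  assumes "I \<in> J (2 * m) (2 * k + 1)"
  shows "frontier m k I (0, 0)"
proof -
  have "0 \<le> vcoord k q" if "dark I q" "0 < ucoord k q" for q
  proof (cases "0 \<le> snd q")
    case True
    with dark_nonneg_bounds(1)[OF assms that(1)] show ?thesis by simp
  next
    case False
    with coord_diff_neg[of q k] that(2) show ?thesis by simp
  qed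
  then show ?thesis by (auto simp: frontier_def visible_origin)
qed

lemma dark_nonneg_fst_le:
  assumes "I \<in> J (2 * m) (2 * k + 1)" "dark I p" "0 \<le> snd p"
  shows "fst p \<le> real m"
  using dark_nonneg_bounds[OF assms] coord_diff_nonneg[OF assms(3), of k] fst_eq_coords[of p k] by simp

text \<open>A down step keeps \<open>u\<close> and raises \<open>v\<close>, so it leads
  \<open>below\<close> \<open>p\<close>. The origin need not be dark, but there \<open>u = 0\<close>
  puts the target outside \<open>poset_R\<close>. Consequently the map can stop only where a down
  step would leave the strip.\<close>

lemma frontier_dark_down:
  assumes "I \<in> J (2 * m) (2 * k + 1)" "frontier m k I p"
  shows "dark I (down k p)"
proof (cases "p = (0, 0)")
  case True
  then show ?thesis
    using dark_if_outside[OF assms(1), of "down k p"] assms(2) by (simp add: frontier_def)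
next
  case False
  then show ?thesis
    using dark_below[OF assms(1), of p "down k p"] assms(2) by (auto simp: frontier_def below_def)
qed

text \<open>Every case of the map is controlled by this: a dark point not yet passed, with
  \<open>v\<close> less than one down step ahead, forces a dark point within reach in the row of
  \<open>p\<close>. The row of \<open>q\<close> cannot be lower, as the gain in \<open>v\<close> is
  less than \<open>2 * k + 1\<close> while \<open>u\<close> increases.\<close>

lemma frontier_dark_ahead:
  assumes I: "I \<in> J (2 * m) (2 * k + 1)" and p: "frontier m k I p" and "k > 0"
    and q: "dark I q" "ucoord k p < ucoord k q" "vcoord k q < vcoord k p + (2 * real k + 1)"
  obtains l where "1 \<le> l" "l \<le> 2 * k" "dark I (right l p)" "below k (right l p) q"
    "vcoord k q = vcoord k p + real l \<or>
       vcoord k q = vcoord k p \<and> l = 1 \<and> ucoord k p + (2 * real k + 1) \<le> ucoord k q"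
proof -
  have vis: "visible p" "visible q" using p q by (auto simp: frontier_def dark_def)
  obtain u v where uv: "ucoord k p = of_int u" "vcoord k p = of_int v"
    "u - v = snd p * (2 * int k + 1)" using visible_coords[OF vis(1)] .
  obtain u' v' where uv': "ucoord k q = of_int u'" "vcoord k q = of_int v'"
    "u' - v' = snd q * (2 * int k + 1)" using visible_coords[OF vis(2)] .
  have "vcoord k p \<le> vcoord k q" using p q unfolding frontier_def by blast
  then have v: "v \<le> v'" "v' < v + (2 * int k + 1)" "u < u'"
    using q uv uv' by linarith+
  define X where "X = (snd q - snd p) * (2 * int k + 1)"
  have d: "u' - u = (v' - v) + X"
    using uv(3) uv'(3) by (simp add: X_def algebra_simps)
  have row: "c * (2 * int k + 1) \<le> X" if "c \<le> snd q - snd p" for c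
    unfolding X_def using that by (intro mult_right_mono) auto
  have row': "X \<le> c * (2 * int k + 1)" if "snd q - snd p \<le> c" for c
    unfolding X_def using that by (intro mult_right_mono) auto
  show thesis
  proof (cases "v' = v")
    \<comment> \<open>Equal \<open>v\<close> and larger \<open>u\<close> place \<open>q\<close> in a
      strictly higher row, so \<open>u\<close> grows by at least \<open>2 * k + 1\<close> and
      already \<open>right 1 p\<close> is \<open>below\<close> \<open>q\<close>.\<close>
    case True
    have "1 \<le> snd q - snd p"
      using row'[of 0] d v True by force
    then have "u + (2 * int k + 1) \<le> u'"
      using row[OF \<open>1 \<le> snd q - snd p\<close>] d True by simp
    then have "ucoord k p + (2 * real k + 1) \<le> ucoord k q"
      using uv uv' by linarith
    moreover have "below k (right 1 p) q"
      using calculation True uv uv' \<open>k > 0\<close> by (simp add: below_def)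
    moreover have "dark I (right 1 p)"
      using dark_below[OF I q(1) _ calculation(2)] vis by simp
    ultimately show thesis using that[of 1] True uv uv' \<open>k > 0\<close> by simp
  next
    case False
    define l where "l = nat (v' - v)"
    have l: "int l = v' - v" "1 \<le> l" "l \<le> 2 * k" using v False by (auto simp: l_def)
    have "0 \<le> snd q - snd p"
      using row'[of "-1"] d v by force
    then have "u + (v' - v) \<le> u'"
      using row[OF \<open>0 \<le> snd q - snd p\<close>] d by simp
    then have "below k (right l p) q"
      using uv uv' l(1) by (simp add: below_def)
    moreover have "dark I (right l p)"
      using dark_below[OF I q(1) _ calculation] vis by simp
    moreover have "vcoord k q = vcoord k p + real l"
      using uv uv' l(1) by linarith
    ultimately show thesis using that[of l] l by simp
  qed
qed

text \<open>In negative rows every visible point with \<open>v > m + k\<close> is dark, whatever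
  \<open>I\<close> is. The first such point of the row has \<open>v = m + k + 1\<close>, and
  \<open>u \<le> v - (2 * k + 1)\<close> keeps it inside the strip.\<close>

lemma frontier_black_boundary:
  assumes I: "I \<in> J (2 * m) (2 * k + 1)" and p: "frontier m k I p"
    and "snd p < 0" "vcoord k p < real m + real k + 1"
  obtains l where "1 \<le> l" "vcoord k p + real l = real m + real k + 1" "black m I (right l p)"
proof -
  obtain v where v: "vcoord k p = of_int v"
    using visible_coords p unfolding frontier_def by metis
  define l where "l = nat (int m + int k + 1 - v)"
  have "v < int m + int k + 1" using assms(4) v by linarith
  then have l: "1 \<le> l" "vcoord k p + real l = real m + real k + 1"
    using v by (auto simp: l_def)
  have "dark I (right l p)"
    by (rule dark_if_outside[OF I]) (use p assms l in \<open>auto simp: frontier_def\<close>)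
  moreover have "fst (right l p) \<le> real m + 1/2"
    using coord_diff_neg[of p k] fst_eq_coords[of p k] assms(3) l(2) by simp
  ultimately have "black m I (right l p)"
    using p by (auto simp: black_iff_dark frontier_def)
  with l that show thesis by blast
qed

text \<open>The line \<open>v = m + k + 1\<close> meets row -1 exactly on the right edge of the
  strip.\<close>

lemma frontier_at_boundary:
  assumes "frontier m k I p" "snd p < 0" "vcoord k p = real m + real k + 1"
  shows "p = (real m + 1/2, -1) \<or> snd p \<le> -2"
proof (cases "snd p = -1")
  case True
  then have "fst p = real m + 1/2" using assms(3) by (simp add: vcoord_def)
  with True show ?thesis by (simp add: prod_eq_iff)
qed (use assms(2) in linarith)

text \<open>The black point on the line \<open>v = m + k + 1\<close> must be out of reach, so a down
  step does not cross that line. If \<open>p\<close> is on the line in row -2 or lower, the point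
  \<open>right 1 p\<close> would be black.\<close>

lemma frontier_no_black_ahead:
  assumes I: "I \<in> J (2 * m) (2 * k + 1)" and p: "frontier m k I p" and "k > 0" "snd p < 0"
    and none: "\<And>j. 1 \<le> j \<Longrightarrow> j \<le> 2 * k \<Longrightarrow> \<not> black m I (right j p)"
  shows "vcoord k p + (2 * real k + 1) \<le> real m + real k + 1 \<or> p = (real m + 1/2, -1)"
proof (cases "vcoord k p < real m + real k + 1")
  case True
  then obtain l where l: "1 \<le> l" "vcoord k p + real l = real m + real k + 1" "black m I (right l p)"
    using frontier_black_boundary I p \<open>snd p < 0\<close> by metis
  with none have "2 * k + 1 \<le> l" by force
  with l show ?thesis by linarith
next
  case False
  then have v: "vcoord k p = real m + real k + 1" using p by (simp add: frontier_def)
  have False if "snd p \<le> -2"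
  proof -
    have "dark I (right 1 p)"
      by (rule dark_if_outside[OF I]) (use p assms v in \<open>auto simp: frontier_def\<close>)
    moreover have "fst (right 1 p) \<le> real m + 1/2"
      using coord_diff_le[OF that, of k] fst_eq_coords[of p k] v \<open>k > 0\<close> by simp
    ultimately show False
      using none[of 1] p \<open>k > 0\<close> by (auto simp: black_iff_dark frontier_def)
  qed
  then show ?thesis using frontier_at_boundary p assms(4) v by blast
qed

text \<open>For up steps the invariant is immediate, as \<open>v\<close> stays fixed. For the
  others, a violating dark point yields by \<open>frontier_dark_ahead\<close> a black point that the
  map would have preferred.\<close>

lemma frontier_step:
  assumes I: "I \<in> J (2 * m) (2 * k + 1)" and p: "frontier m k I p" and k: "k > 0"
    and r: "psi_next m k I p = Some r"
  shows "frontier m k I r" "ballot_step (2 * k + 1) p r"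
proof -
  have inv: "\<And>q. dark I q \<Longrightarrow> ucoord k p < ucoord k q \<Longrightarrow> vcoord k p \<le> vcoord k q"
    and vb: "vcoord k p \<le> real m + real k + 1" and p0: "0 \<le> fst p" and pv: "visible p"
    using p unfolding frontier_def by blast+
  have frontierI: "frontier m k I r" if "black m I r" "vcoord k r \<le> real m + real k + 1"
    "\<And>q. dark I q \<Longrightarrow> ucoord k r < ucoord k q \<Longrightarrow> vcoord k q < vcoord k r \<Longrightarrow> False"
    using that unfolding frontier_def black_iff_dark by (meson dark_def not_le)
  have "frontier m k I r \<and> ballot_step (2 * k + 1) p r"
    using r
  proof (cases rule: psi_next_cases)
    case up
    have "frontier m k I r"
    proof (rule frontierI[OF up(2)])
      fix q assume "dark I q" "ucoord k r < ucoord k q" "vcoord k q < vcoord k r"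
      with inv[of q] up show False by simp
    qed (use vb up in simp)
    with up show ?thesis unfolding ballot_step_iff by blast
  next
    case (right l)
    have rm: "fst p + real l \<le> real m + 1/2"
      using right by (simp add: black_iff_dark)
    have "vcoord k r \<le> real m + real k + 1"
    proof (cases "0 \<le> snd p")
      case True
      then have "0 \<le> snd r" "dark I r" using right by (auto simp: black_iff_dark)
      with dark_nonneg_bounds[OF I this(2,1)] coord_diff_nonneg[OF this(1), of k] show ?thesis by simp
    next
      case neg: False
      show ?thesis
      proof (cases "vcoord k p < real m + real k + 1")
        case True
        then obtain l0 where "1 \<le> l0" "vcoord k p + real l0 = real m + real k + 1"
          "black m I (right l0 p)"
          using frontier_black_boundary[OF I p] neg by (metis not_le)
        with right(6)[of l0] right(3) show ?thesis by (cases "l0 < l") auto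
      next
        \<comment> \<open>On the boundary line and below row -1, \<open>up k p\<close> stays on the
          line in a negative row; it is therefore black, against the choice of a right step.\<close>
        case False
        then have v: "vcoord k p = real m + real k + 1" using vb by simp
        have "p \<noteq> (real m + 1/2, -1)" using rm right(1) by auto
        then have two: "snd p \<le> -2" using frontier_at_boundary[OF p _ v] neg by auto
        have "dark I (up k p)"
          by (rule dark_if_outside[OF I]) (use pv two v in auto)
        moreover have "fst (up k p) \<le> real m + 1/2"
          using coord_diff_le[OF two, of k] fst_eq_coords[of p k] v by simp
        ultimately have "black m I (up k p)" using p0 by (simp add: black_iff_dark)
        with right show ?thesis by blast
      qed
    qed
    moreover have False
      if q: "dark I q" "ucoord k r < ucoord k q" "vcoord k q < vcoord k r" for q
    proof -
      have "ucoord k p < ucoord k q" "vcoord k q < vcoord k p + (2 * real k + 1)"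
        using q right(2,3) by auto
      then obtain j where j: "1 \<le> j" "j \<le> 2 * k" "dark I (right j p)"
        "vcoord k q = vcoord k p + real j \<or>
         vcoord k q = vcoord k p \<and> j = 1 \<and> ucoord k p + (2 * real k + 1) \<le> ucoord k q"
        using frontier_dark_ahead[OF I p k q(1)] by metis
      from j(4) show False
      proof
        assume "vcoord k q = vcoord k p + real j"
        then have "j < l" using q(3) right(3) by simp
        then have "black m I (right j p)" using j(3) rm p0 by (simp add: black_iff_dark)
        with right(6) j(1) \<open>j < l\<close> show False by blast
      next
        \<comment> \<open>Now \<open>up k p\<close> is \<open>below\<close> \<open>q\<close>, so an
          up step would have been taken.\<close>
        assume e: "vcoord k q = vcoord k p \<and> j = 1 \<and> ucoord k p + (2 * real k + 1) \<le> ucoord k q"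
        then have d: "dark I (up k p)"
          using dark_below[OF I q(1), of "up k p"] pv by (simp add: below_def)
        have "fst (up k p) \<le> real m + 1/2"
        proof (cases "0 \<le> snd (up k p)")
          case True
          with dark_nonneg_fst_le[OF I d] show ?thesis by simp
        next
          case False
          then show ?thesis
            using coord_diff_neg[of "up k p" k] fst_eq_coords[of "up k p" k] vb by simp
        qed
        then have "black m I (up k p)" using p0 d by (simp add: black_iff_dark)
        with right show False by blast
      qed
    qed
    ultimately have "frontier m k I r" using frontierI right by blast
    with right show ?thesis unfolding ballot_step_iff by blast
  next
    case down
    have rm: "fst p + real k + 1/2 \<le> real m + 1/2"
      using down by (simp add: black_iff_dark)
    have gap: "vcoord k p + (2 * real k + 1) \<le> real m + real k + 1" if "snd p < 0"
      using frontier_no_black_ahead[OF I p k that] down(3) rm by auto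
    have "vcoord k r \<le> real m + real k + 1"
    proof (cases "0 \<le> snd p")
      case True
      \<comment> \<open>In rows at least -1 the right edge of the strip already gives
        \<open>v \<le> m + k + 1\<close>.\<close>
      then have "- 1 \<le> snd r" using down by simp
      with coord_diff_ge[OF this, of k] fst_eq_coords[of r k] rm down(1) show ?thesis by simp
    qed (use gap down in simp)
    moreover have False
      if q: "dark I q" "ucoord k r < ucoord k q" "vcoord k q < vcoord k r" for q
    proof -
      have "ucoord k p < ucoord k q" "vcoord k q < vcoord k p + (2 * real k + 1)"
        using q down(1) by auto
      then obtain j where j: "1 \<le> j" "j \<le> 2 * k" "dark I (right j p)"
        using frontier_dark_ahead[OF I p k q(1)] by metis
      have "fst (right j p) \<le> real m + 1/2"
      proof (cases "0 \<le> snd p")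
        case True
        then show ?thesis using dark_nonneg_fst_le[OF I j(3)] by simp
      next
        case False
        then show ?thesis
          using coord_diff_neg[of p k] fst_eq_coords[of p k] gap j(2) by simp
      qed
      then have "black m I (right j p)" using j(3) p0 by (simp add: black_iff_dark)
      with down(3) j show False by blast
    qed
    ultimately have "frontier m k I r" using frontierI down by blast
    with down show ?thesis unfolding ballot_step_iff by blast
  qed
  then show "frontier m k I r" "ballot_step (2 * k + 1) p r" by auto
qed

text \<open>No black point is skipped by a step. For an up step this is the invariant at
  \<open>p\<close>, for a right step the minimality of its length, and a down step leaves
  \<open>u\<close> unchanged.\<close>

lemma frontier_step_covers:
  assumes I: "I \<in> J (2 * m) (2 * k + 1)" and p: "frontier m k I p" and k: "k > 0"
    and r: "psi_next m k I p = Some r" and q: "black m I q" "ucoord k p < ucoord k q"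
  shows "ucoord k r < ucoord k q \<or> below k q r"
proof -
  have d: "dark I q" using q by (simp add: black_iff_dark)
  then have v: "vcoord k p \<le> vcoord k q" using p q(2) unfolding frontier_def by blast
  from r show ?thesis
  proof (cases rule: psi_next_cases)
    case up
    with v show ?thesis by (auto simp: below_def)
  next
    case (right l)
    show ?thesis
    proof (rule ccontr)
      assume "\<not> ?thesis"
      then have a: "ucoord k q \<le> ucoord k p + real l" "vcoord k q < vcoord k p + real l"
        using right(3) by (auto simp: below_def)
      then have "vcoord k q < vcoord k p + (2 * real k + 1)" using right(2) by simp
      then obtain j where j: "1 \<le> j" "dark I (right j p)"
        "vcoord k q = vcoord k p + real j \<or>
         vcoord k q = vcoord k p \<and> j = 1 \<and> ucoord k p + (2 * real k + 1) \<le> ucoord k q"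
        using frontier_dark_ahead[OF I p k d q(2)] by metis
      then have "j < l" using a right(2) by auto
      moreover have "fst p + real l \<le> real m + 1/2" "0 \<le> fst p"
        using right p by (auto simp: black_iff_dark frontier_def)
      ultimately have "black m I (right j p)" using j(2) by (simp add: black_iff_dark)
      with right(6) j(1) \<open>j < l\<close> show False by blast
    qed
  next
    case down
    with q show ?thesis by simp
  qed
qed

lemma frontier_stop_covers:
  assumes I: "I \<in> J (2 * m) (2 * k + 1)" and p: "frontier m k I p" and k: "k > 0"
    and stop: "psi_next m k I p = None" and q: "black m I q"
  shows "ucoord k q \<le> ucoord k p"
proof (rule ccontr)
  assume "\<not> ?thesis"
  then have u: "ucoord k p < ucoord k q" by simp
  have p0: "0 \<le> fst p" using p by (simp add: frontier_def)
  have d: "dark I q" and qm: "fst q \<le> real m + 1/2" using q by (auto simp: black_iff_dark)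
  have "real m + 1/2 < fst (down k p)"
    using stop frontier_dark_down[OF I p] p0 by (auto simp: psi_next_None_iff black_iff_dark)
  \<comment> \<open>Twice the abscissa is \<open>u + v\<close>: since \<open>q\<close> is in the
    strip, \<open>down k p\<close> is not, and \<open>u\<close> is larger at \<open>q\<close>, the
    value of \<open>v\<close> is smaller at \<open>q\<close>.\<close>
  then have "vcoord k q < vcoord k p + (2 * real k + 1)"
    using fst_eq_coords[of p k] fst_eq_coords[of q k] u qm unfolding fst_down by (simp add: field_simps)
  then obtain j where j: "1 \<le> j" "j \<le> 2 * k" "dark I (right j p)" "below k (right j p) q"
    "vcoord k q = vcoord k p + real j \<or>
     vcoord k q = vcoord k p \<and> j = 1 \<and> ucoord k p + (2 * real k + 1) \<le> ucoord k q"
    using frontier_dark_ahead[OF I p k d u] by metis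
  then have "fst (right j p) \<le> fst q"
    using fst_eq_coords[of p k] fst_eq_coords[of q k] k by (auto simp: below_def)
  then have "black m I (right j p)" using qm j(3) p0 by (simp add: black_iff_dark)
  with stop j show False by (auto simp: psi_next_None_iff)
qed

text \<open>A stop means \<open>x > m - k\<close>. In positive rows \<open>u \<le> m\<close>
  contradicts this, in row 0 \<open>x\<close> is an integer at most \<open>m\<close>, and in
  negative rows \<open>frontier_no_black_ahead\<close> leaves only the corner.\<close>

lemma frontier_stop_end:
  assumes I: "I \<in> J (2 * m) (2 * k + 1)" and p: "frontier m k I p" and k: "k > 0"
    and stop: "psi_next m k I p = None"
  shows "p = (real m + 1/2, -1) \<or> (\<exists>i<k. p = (real m - real i, 0))"
proof -
  have p0: "0 \<le> fst p" using p by (simp add: frontier_def)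
  have far: "real m + 1/2 < fst p + real k + 1/2"
    using stop frontier_dark_down[OF I p] p0 by (auto simp: psi_next_None_iff black_iff_dark)
  have dk: "dark I p" if "p \<noteq> (0, 0)" using p that by (simp add: frontier_def)
  consider "1 \<le> snd p" | "snd p = 0" | "snd p < 0" by linarith
  then show ?thesis
  proof cases
    case 1
    then have "p \<noteq> (0, 0)" by auto
    with 1 dk have "ucoord k p \<le> real m" using dark_nonneg_bounds(2)[OF I, of p] by simp
    then have False
      using coord_diff_ge[OF 1, of k] fst_eq_coords[of p k] far by simp
    then show ?thesis ..
  next
    case 2
    have "fst p \<le> real m"
    proof (cases "p = (0, 0)")
      case False
      then show ?thesis using dark_nonneg_fst_le[OF I dk] 2 by simp
    qed simp
    moreover obtain u where u: "fst p = of_int u"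
      using p 2 by (auto simp: frontier_def visible_def elim: Ints_cases)
    ultimately have "u \<le> int m" "int m < u + int k" using far by linarith+
    then have "nat (int m - u) < k" "fst p = real m - real (nat (int m - u))"
      using u by auto
    with 2 show ?thesis by (metis prod.collapse)
  next
    case 3
    have "\<not> vcoord k p + (2 * real k + 1) \<le> real m + real k + 1"
      using coord_diff_neg[OF 3, of k] fst_eq_coords[of p k] far by simp
    then show ?thesis
      using frontier_no_black_ahead[OF I p k 3] stop by (auto simp: psi_next_None_iff)
  qed
qed

text \<open>The last two conclusions let the path determine the region: dark vertices make
  everything \<open>below\<close> them dark, and no black point is missed.\<close>

lemma psi_from_frontier:
  assumes I: "I \<in> J (2 * m) (2 * k + 1)" and k: "k > 0" and "frontier m k I p"
  defines "ps \<equiv> psi_from m k I p"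
  shows "successively (ballot_step (2 * k + 1)) ps"
    and "last ps = (real m + 1/2, -1) \<or> (\<exists>i<k. last ps = (real m - real i, 0))"
    and "\<And>r. r \<in> set ps \<Longrightarrow> r = (0, 0) \<or> dark I r"
    and "\<And>q. black m I q \<Longrightarrow> ucoord k p < ucoord k q \<Longrightarrow> \<exists>r\<in>set ps. below k q r"
proof -
  have "successively (ballot_step (2 * k + 1)) ps \<and>
    (last ps = (real m + 1/2, -1) \<or> (\<exists>i<k. last ps = (real m - real i, 0))) \<and>
    (\<forall>r\<in>set ps. r = (0, 0) \<or> dark I r) \<and>
    (\<forall>q. black m I q \<longrightarrow> ucoord k p < ucoord k q \<longrightarrow> (\<exists>r\<in>set ps. below k q r))"
    using I k assms(3) unfolding ps_def
  proof (induction m k I p rule: psi_from.induct)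
    case (1 m k I p)
    have pd: "p = (0, 0) \<or> dark I p" using 1(4) by (simp add: frontier_def)
    show ?case
    proof (cases "psi_next m k I p")
      case None
      then have e: "psi_from m k I p = [p]" by (simp add: psi_from.simps[of m k I p])
      show ?thesis unfolding e
      proof (intro conjI allI impI)
        show "last [p] = (real m + 1/2, -1) \<or> (\<exists>i<k. last [p] = (real m - real i, 0))"
          using frontier_stop_end[OF 1(2,4,3) None] by simp
      next
        fix q assume "black m I q" "ucoord k p < ucoord k q"
        with frontier_stop_covers[OF 1(2,4,3) None, of q] show "\<exists>r\<in>set [p]. below k q r" by simp
      qed (use pd in simp_all)
    next
      case (Some r)
      note step = frontier_step[OF 1(2,4,3) Some]
      note IH = 1(1)[OF Some 1(2,3) step(1)]
      have e: "psi_from m k I p = p # psi_from m k I r"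
        using Some by (simp add: psi_from.simps[of m k I p])
      obtain rest where rest: "psi_from m k I r = r # rest" by (metis psi_from.simps)
      have covered: "\<exists>r'\<in>set (r # rest). below k q r'"
        if q: "black m I q" "ucoord k p < ucoord k q" for q
        using frontier_step_covers[OF 1(2,4,3) Some q]
      proof
        assume "ucoord k r < ucoord k q"
        with IH q(1) show ?thesis unfolding rest by blast
      qed simp
      show ?thesis unfolding e rest
      proof (intro conjI allI impI)
        show "successively (ballot_step (2 * k + 1)) (p # r # rest)"
          using IH step(2) rest by simp
        show "last (p # r # rest) = (real m + 1/2, -1) \<or>
          (\<exists>i<k. last (p # r # rest) = (real m - real i, 0))"
          using IH rest by simp
        show "\<forall>x\<in>set (p # r # rest). x = (0, 0) \<or> dark I x"
          using IH rest pd by simp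
      next
        fix q assume "black m I q" "ucoord k p < ucoord k q"
        from covered[OF this] show "\<exists>x\<in>set (p # r # rest). below k q x" by simp
      qed
    qed
  qed
  then show "successively (ballot_step (2 * k + 1)) ps"
    and "last ps = (real m + 1/2, -1) \<or> (\<exists>i<k. last ps = (real m - real i, 0))"
    and "\<And>r. r \<in> set ps \<Longrightarrow> r = (0, 0) \<or> dark I r"
    and "\<And>q. black m I q \<Longrightarrow> ucoord k p < ucoord k q \<Longrightarrow> \<exists>r\<in>set ps. below k q r"
    by blast+
qed

lemma psi_Cons: "\<exists>rest. psi m k I = (0, 0) # rest"
  unfolding psi_def by (metis psi_from.simps)

text \<open>The first step cannot go up: it would keep \<open>v = 0\<close>, whereas dark points of
  nonnegative rows have \<open>v \<ge> 1\<close>.\<close>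

lemma psi_mem_Q':
  assumes I: "I \<in> J (2 * m) (2 * k + 1)" and k: "k > 0"
  shows "psi m k I \<in> Q' m k"
proof -
  note path = psi_from_frontier[OF I k frontier_origin[OF I], folded psi_def]
  obtain rest where ps: "psi m k I = (0, 0) # rest" using psi_Cons by blast
  have "snd (psi m k I ! 1) = 0 \<or> snd (psi m k I ! 1) = -1" if len: "2 \<le> length (psi m k I)"
  proof -
    obtain r rest' where r: "rest = r # rest'" using len ps by (cases rest) auto
    have "r \<noteq> up k (0, 0)"
    proof
      assume a: "r = up k (0, 0)"
      then have "dark I r" using path(3)[of r] ps r by (auto simp: up_def)
      from dark_nonneg_bounds(1)[OF I this] a show False by simp
    qed
    moreover have "ballot_step (2 * k + 1) (0, 0) r" using path(1) by (simp add: ps r)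
    ultimately show ?thesis unfolding ballot_step_iff by (auto simp: ps r)
  qed
  with path(1,2) show ?thesis
    unfolding Q'_def free_ballot'_def free_ballot_def by (auto simp: ps)
qed

text \<open>The path thus determines the colouring. The origin is excepted because it is a vertex of
  every traced path but is never black.\<close>

lemma black_iff_below_psi:
  assumes I: "I \<in> J (2 * m) (2 * k + 1)" and k: "k > 0" and "q \<noteq> (0, 0)"
  shows "black m I q \<longleftrightarrow> visible q \<and> 0 \<le> fst q \<and> fst q \<le> real m + 1/2 \<and>
    (\<exists>r\<in>set (psi m k I). below k q r)"
proof
  note path = psi_from_frontier[OF I k frontier_origin[OF I], folded psi_def]
  {
    assume q: "black m I q"
    have "\<exists>r\<in>set (psi m k I). below k q r"
    proof (cases "0 < ucoord k q")
      case True
      then show ?thesis using path(4)[OF q] by simp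
    next
      case False
      \<comment> \<open>If \<open>u \<le> 0\<close>, then \<open>x \<ge> 0\<close> forces
        \<open>v \<ge> 0\<close>.\<close>
      then have "below k q (0, 0)"
        using q fst_eq_coords[of q k] by (simp add: below_def black_iff_dark)
      then show ?thesis using psi_Cons by (metis list.set_intros(1))
    qed
    with q show "visible q \<and> 0 \<le> fst q \<and> fst q \<le> real m + 1/2 \<and>
      (\<exists>r\<in>set (psi m k I). below k q r)"
      by (auto simp: black_def)
  }
  assume q: "visible q \<and> 0 \<le> fst q \<and> fst q \<le> real m + 1/2 \<and>
    (\<exists>r\<in>set (psi m k I). below k q r)"
  then obtain r where r: "r \<in> set (psi m k I)" "below k q r" by blast
  have "dark I q"
  proof (cases "r = (0, 0)")
    case True
    then have "snd q < 0"
      using below_snd_le[OF r(2)] below_same_row[OF r(2)] assms(3) by fastforce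
    then show ?thesis
      using dark_if_outside[OF I] q r True by (simp add: below_def)
  next
    case False
    then have "dark I r" using path(3) r by blast
    then show ?thesis using dark_below[OF I _ _ r(2)] q by blast
  qed
  with q show "black m I q" by (simp add: black_iff_dark)
qed

section \<open>The ideal below a path\<close>

definition beneath :: "nat \<Rightarrow> point list \<Rightarrow> point \<Rightarrow> bool" where
  "beneath k ps q \<longleftrightarrow> (\<exists>p\<in>set ps. below k q p)"

text \<open>The equivalence covers both halves at once: in \<open>poset_R\<close> the members of the
  ideal are the points that are not black.\<close>

definition path_ideal :: "nat \<Rightarrow> nat \<Rightarrow> point list \<Rightarrow> point set" where
  "path_ideal m k ps = {q \<in> poset_P (2 * m) (2 * k + 1). 0 \<le> snd q \<longleftrightarrow> beneath k ps q}"

text \<open>The product order of the diagonal coordinates, in which a ballot path is a chain;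
  \<open>below\<close> reverses its second component.\<close>

definition coords_le :: "nat \<Rightarrow> point \<Rightarrow> point \<Rightarrow> bool" where
  "coords_le k p q \<longleftrightarrow> ucoord k p \<le> ucoord k q \<and> vcoord k p \<le> vcoord k q"

lemma coords_le_fst: "coords_le k p q \<Longrightarrow> fst p \<le> fst q"
  by (simp add: coords_le_def fst_eq_coords[of p k] fst_eq_coords[of q k])

lemma ballot_step_coords_le: "ballot_step (2 * k + 1) p q \<Longrightarrow> coords_le k p q"
  unfolding ballot_step_iff by (auto simp: coords_le_def)

lemma path_sorted:
  assumes "successively (ballot_step (2 * k + 1)) ps"
  shows "sorted_wrt (coords_le k) ps"
proof -
  have "successively (coords_le k) ps"
    using assms ballot_step_coords_le by (rule successively_mono)
  moreover have "transp (coords_le k)"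
    by (auto simp: transp_def coords_le_def)
  ultimately show ?thesis by (simp add: successively_conv_sorted_wrt)
qed

lemma path_visible:
  assumes "successively (ballot_step (2 * k + 1)) ps" "ps \<noteq> []" "visible (hd ps)" "p \<in> set ps"
  shows "visible p"
  using assms
proof (induction ps rule: induct_list012)
  case (3 x y zs)
  have "ballot_step (2 * k + 1) x y" using 3(3) by simp
  then have "visible y" using 3(5) unfolding ballot_step_iff by auto
  with 3 show ?case by auto
qed auto

section \<open>Recovering a path from the region beneath it\<close>

locale Q'_path =
  fixes m k :: nat and ps :: "point list"
  assumes k_pos: "k > 0" and mem_Q': "ps \<in> Q' m k"
begin

lemma steps: "successively (ballot_step (2 * k + 1)) ps"
  and path_Cons: "\<exists>rest. ps = (0, 0) # rest"
  and path_end: "last ps = (real m + 1/2, -1) \<or> (\<exists>i<k. last ps = (real m - real i, 0))"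
  and first_step: "2 \<le> length ps \<Longrightarrow> snd (ps ! 1) = 0 \<or> snd (ps ! 1) = -1"
proof -
  have ne: "ps \<noteq> []" "hd ps = (0, 0)" and "successively (ballot_step (2 * k + 1)) ps"
    and fs: "2 \<le> length ps \<Longrightarrow> snd (ps ! 1) = snd (ps ! 0) \<or> snd (ps ! 1) = snd (ps ! 0) - 1"
    and "last ps = (real m + 1/2, -1) \<or> (\<exists>i<k. last ps = (real m - real i, 0))"
    using mem_Q' unfolding Q'_def free_ballot'_def free_ballot_def by auto
  then show "successively (ballot_step (2 * k + 1)) ps"
    "last ps = (real m + 1/2, -1) \<or> (\<exists>i<k. last ps = (real m - real i, 0))" by blast+
  show c: "\<exists>rest. ps = (0, 0) # rest" using ne by (metis list.collapse)
  show "2 \<le> length ps \<Longrightarrow> snd (ps ! 1) = 0 \<or> snd (ps ! 1) = -1" using fs c by auto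
qed

lemma origin_le: "p \<in> set ps \<Longrightarrow> coords_le k (0, 0) p"
  using path_sorted[OF steps] path_Cons by (auto simp: coords_le_def)

lemma le_last: "p \<in> set ps \<Longrightarrow> coords_le k p (last ps)"
proof -
  assume p: "p \<in> set ps"
  then have ps: "ps = butlast ps @ [last ps]" by (metis append_butlast_last_id empty_iff empty_set)
  then have "sorted_wrt (coords_le k) (butlast ps @ [last ps])" using path_sorted[OF steps] by simp
  moreover have "p \<in> set (butlast ps) \<or> p = last ps" using p ps
    by (metis in_set_conv_decomp_last rotate1.simps(2) set_ConsD set_rotate1)
  ultimately show ?thesis by (auto simp: sorted_wrt_append coords_le_def)
qed

text \<open>At \<open>(m + 1/2, -1)\<close> one has \<open>u = m - k\<close> and
  \<open>v = m + k + 1\<close>; at \<open>(m - i, 0)\<close> both coordinates are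
  \<open>m - i\<close>.\<close>

lemma last_bounds:
  "ucoord k (last ps) \<le> real m" "real m - real k \<le> ucoord k (last ps)"
  "vcoord k (last ps) \<le> real m + real k + 1" "fst (last ps) \<le> real m + 1/2"
  using path_end by (auto simp: ucoord_def vcoord_def)

lemma path_strip:
  assumes "p \<in> set ps"
  shows "visible p" "0 \<le> fst p" "fst p \<le> real m + 1/2"
proof -
  obtain rest where "ps = (0, 0) # rest" using path_Cons by blast
  then show "visible p"
    using path_visible[OF steps _ _ assms] visible_origin by simp
  show "0 \<le> fst p" using coords_le_fst[OF origin_le[OF assms]] by simp
  show "fst p \<le> real m + 1/2"
    using coords_le_fst[OF le_last[OF assms]] last_bounds(4) by linarith
qed

text \<open>The restriction on the first step enters here: a first step that is horizontal or down
  makes \<open>v\<close> at least 1, and \<open>v\<close> never decreases afterwards.\<close>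

lemma vcoord_pos:
  assumes "ps = (0, 0) # rest" "p \<in> set rest"
  shows "1 \<le> vcoord k p"
proof -
  obtain r rest' where rest: "rest = r # rest'" using assms(2) by (cases rest) auto
  have step: "ballot_step (2 * k + 1) (0, 0) r" using steps by (simp add: assms rest)
  have "snd r = 0 \<or> snd r = -1" using first_step by (simp add: assms rest)
  then have "r \<noteq> up k (0, 0)" by auto
  with step have "r = down k (0, 0) \<or> (\<exists>l\<ge>1. r = right l (0, 0))"
    unfolding ballot_step_iff by blast
  then have "1 \<le> vcoord k r" by auto
  have "vcoord k r \<le> vcoord k p"
    using path_sorted[OF steps] assms(2) by (auto simp: assms(1) rest coords_le_def)
  with \<open>1 \<le> vcoord k r\<close> show ?thesis by simp
qed

lemma beneath_trans: "beneath k ps p \<Longrightarrow> below k q p \<Longrightarrow> beneath k ps q"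
  unfolding beneath_def by (meson below_trans)

lemma beneath_nonneg_mem_L:
  assumes "visible q" "0 \<le> fst q" "0 \<le> snd q" "q \<noteq> (0, 0)" "beneath k ps q"
  shows "q \<in> poset_L (2 * m) (2 * k + 1)"
proof -
  obtain p where p: "p \<in> set ps" "below k q p" using assms(5) by (auto simp: beneath_def)
  have "ucoord k q \<le> real m"
    using p le_last[OF p(1)] last_bounds(1) by (simp add: below_def coords_le_def)
  moreover have "1 \<le> vcoord k q"
  proof (cases "p = (0, 0)")
    case True
    then have "q = (0, 0)"
      using below_snd_le[OF p(2)] below_same_row[OF p(2)] assms(3) by simp
    with assms(4) show ?thesis by simp
  next
    case False
    obtain rest where "ps = (0, 0) # rest" using path_Cons by blast
    with False p(1) have "1 \<le> vcoord k p" using vcoord_pos by simp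
    with p(2) show ?thesis by (simp add: below_def)
  qed
  ultimately show ?thesis using assms unfolding mem_poset_L by blast
qed

text \<open>Outside \<open>poset_R\<close>, either \<open>u \<le> 0\<close>, and the origin covers
  the point, or \<open>v \<ge> m + k + 1\<close>. In the latter case the strip gives
  \<open>u \<le> m - k\<close>, and the last vertex covers it.\<close>

lemma beneath_neg:
  assumes "visible q" "0 \<le> fst q" "fst q \<le> real m + 1/2" "snd q < 0"
    "q \<notin> poset_R (2 * m) (2 * k + 1)"
  shows "beneath k ps q"
proof -
  obtain u v where uv: "ucoord k q = of_int u" "vcoord k q = of_int v"
    using visible_coords assms(1) by metis
  have "ucoord k q < 1 \<or> real m + real k < vcoord k q"
    using assms unfolding mem_poset_R by auto
  then show ?thesis
  proof
    assume "ucoord k q < 1"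
    then have "u \<le> 0" using uv by simp
    then have "ucoord k q \<le> 0" using uv by simp
    then have "below k q (0, 0)"
      using assms(2) fst_eq_coords[of q k] by (simp add: below_def)
    then show ?thesis using path_Cons by (auto simp: beneath_def)
  next
    assume "real m + real k < vcoord k q"
    then have "int m + int k + 1 \<le> v" using uv by linarith
    then have "real m + real k + 1 \<le> vcoord k q" using uv by linarith
    moreover from this have "ucoord k q \<le> real m - real k"
      using assms(3) fst_eq_coords[of q k] by (simp add: field_simps)
    ultimately have "below k q (last ps)"
      using last_bounds by (auto simp: below_def)
    moreover have "last ps \<in> set ps" using path_Cons by (auto intro: last_in_set)
    ultimately show ?thesis by (auto simp: beneath_def)
  qed
qed

lemma black_path_ideal:
  assumes "0 < fst q"
  shows "black m (path_ideal m k ps) q \<longleftrightarrow> visible q \<and> fst q \<le> real m + 1/2 \<and> beneath k ps q"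
proof (cases "visible q \<and> fst q \<le> real m + 1/2")
  case True
  have q0: "q \<noteq> (0, 0)" using assms by auto
  have "dark (path_ideal m k ps) q \<longleftrightarrow> beneath k ps q"
  proof (cases "0 \<le> snd q")
    case nonneg: True
    then show ?thesis
      using beneath_nonneg_mem_L[of q] q0 assms True
      by (auto simp: dark_def path_ideal_def poset_P_def)
  next
    case False
    then show ?thesis
      using beneath_neg[of q] assms True
      by (auto simp: dark_def path_ideal_def poset_P_def)
  qed
  with True assms show ?thesis by (simp add: black_iff_dark)
qed (auto simp: black_def)

lemma path_ideal_mem_J: "path_ideal m k ps \<in> J (2 * m) (2 * k + 1)"
proof -
  have "dark (path_ideal m k ps) q"
    if p: "dark (path_ideal m k ps) p" and q: "visible q" "below k q p" "snd q = snd p - 1" for p q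
  proof -
    have diff: "ucoord k q - vcoord k q = ucoord k p - vcoord k p - (2 * real k + 1)"
      unfolding coord_diff q(3) by (simp add: algebra_simps)
    \<comment> \<open>Rows 0 and lower are merged in \<open>ben'\<close>: the next row is negative,
      where lying beneath the path suffices for being dark.\<close>
    consider (ben) "beneath k ps p" "1 \<le> snd p" "p \<in> poset_P (2 * m) (2 * k + 1)"
      | (ben') "beneath k ps p" "snd p \<le> 0"
      | (out) "snd p < 0" "p \<notin> poset_P (2 * m) (2 * k + 1)"
      using p by (cases "snd p \<ge> 1") (auto simp: dark_def path_ideal_def split: if_splits)
    then show ?thesis
    proof cases
      case ben
      have "p \<in> poset_L (2 * m) (2 * k + 1)" using poset_P_nonneg[OF ben(3)] ben(2) by simp
      then have "q \<in> poset_L (2 * m) (2 * k + 1)"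
        using q ben(2) unfolding mem_poset_L below_def by auto
      moreover have "beneath k ps q" using beneath_trans[OF ben(1) q(2)] .
      ultimately show ?thesis
        using q(1,3) ben(2) by (simp add: dark_def path_ideal_def poset_P_def)
    next
      case ben'
      have "beneath k ps q" using beneath_trans[OF ben'(1) q(2)] .
      then show ?thesis using q(1,3) ben'(2) by (simp add: dark_def path_ideal_def)
    next
      case out
      have "q \<notin> poset_P (2 * m) (2 * k + 1)"
      proof
        assume "q \<in> poset_P (2 * m) (2 * k + 1)"
        then have "q \<in> poset_R (2 * m) (2 * k + 1)"
          using poset_P_neg q(3) out(1) by simp
        then have "p \<in> poset_R (2 * m) (2 * k + 1)"
          using p q(2) diff out(1) unfolding mem_poset_R below_def dark_def by auto
        with out(2) show False by (simp add: poset_P_def)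
      qed
      then show ?thesis using q(1,3) out(1) by (simp add: dark_def path_ideal_def)
    qed
  qed
  moreover have "path_ideal m k ps \<subseteq> poset_P (2 * m) (2 * k + 1)"
    by (auto simp: path_ideal_def)
  ultimately show ?thesis unfolding J_iff_dark_closed by blast
qed

text \<open>Since \<open>u\<close> is weakly increasing along the path, vertices up to
  \<open>p\<close> cannot cover a point with larger \<open>u\<close>.\<close>

lemma beneath_suffix:
  assumes "ps = pre @ p # suf" "ucoord k p < ucoord k q"
  shows "beneath k ps q \<longleftrightarrow> beneath k suf q"
proof -
  have "\<not> below k q x" if "x \<in> set pre \<union> {p}" for x
  proof -
    have "ucoord k x \<le> ucoord k p"
      using path_sorted[OF steps] that assms(1) by (auto simp: sorted_wrt_append coords_le_def)
    with assms(2) show ?thesis by (simp add: below_def)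
  qed
  then show ?thesis by (auto simp: beneath_def assms(1))
qed

lemma vcoord_suffix:
  assumes "ps = pre @ p # r # suf" "beneath k (r # suf) q"
  shows "vcoord k r \<le> vcoord k q"
proof -
  obtain x where x: "x \<in> set (r # suf)" "below k q x" using assms(2) unfolding beneath_def by blast
  then have "vcoord k r \<le> vcoord k x"
    using path_sorted[OF steps] by (auto simp: assms(1) sorted_wrt_append coords_le_def)
  with x(2) show ?thesis by (simp add: below_def)
qed

text \<open>Induction over the part still to be traced. The next vertex is black, and by
  \<open>beneath_suffix\<close> and \<open>vcoord_suffix\<close> no black point of positive abscissa
  has \<open>u\<close> larger than at \<open>p\<close> and \<open>v\<close> smaller than at the next
  vertex; this forces the choice of the map.\<close>

lemma psi_from_path_ideal:
  assumes "ps = pre @ p # suf"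
  shows "psi_from m k (path_ideal m k ps) p = p # suf"
  using assms
proof (induction suf arbitrary: pre p)
  case Nil
  have p: "p = last ps" "0 \<le> fst p" using Nil path_strip[of p] by simp_all
  have "\<not> black m (path_ideal m k ps) (right j p)" if "1 \<le> j" for j
    using black_path_ideal[of "right j p"] beneath_suffix[OF Nil, of "right j p"] that p(2)
    by (simp add: beneath_def)
  \<comment> \<open>Both kinds of end have \<open>x > m - k\<close>, so a down step leaves the
    strip.\<close>
  moreover have "\<not> black m (path_ideal m k ps) (down k p)"
    using path_end p(1) by (auto simp: black_def)
  ultimately have "psi_next m k (path_ideal m k ps) p = None"
    unfolding psi_next_None_iff by blast
  then show ?case by (simp add: psi_from.simps[of m k _ p])
next
  case (Cons r suf)
  let ?I = "path_ideal m k ps"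
  have strip: "visible p" "0 \<le> fst p" "visible r" "fst r \<le> real m + 1/2"
    using path_strip Cons.prems by auto
  have r_ben: "beneath k ps r" using Cons.prems by (auto simp: beneath_def intro: below_refl)
  have r_black: "black m ?I r" if "0 < fst r"
    using black_path_ideal[OF that] strip r_ben by simp
  have not_black: "\<not> black m ?I q"
    if "0 < fst q" "ucoord k p < ucoord k q" "vcoord k q < vcoord k r" for q
    using black_path_ideal[OF that(1)] beneath_suffix[OF Cons.prems that(2)]
      vcoord_suffix[OF Cons.prems, of q] that(3) by auto
  have "ballot_step (2 * k + 1) p r"
    using steps Cons.prems by (simp add: successively_append_iff)
  then consider (up) "r = up k p" | (down) "r = down k p"
    | (right) l where "1 \<le> l" "l \<le> 2 * k" "r = right l p"
    unfolding ballot_step_iff by blast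
  then have "psi_next m k ?I p = Some r"
  proof cases
    case up
    \<comment> \<open>The first case of the map needs a black point in the row of \<open>p\<close>;
      \<open>right 1 p\<close> is one, being \<open>below\<close> \<open>up k p\<close>.\<close>
    have "beneath k ps (right 1 p)"
      using beneath_trans[OF r_ben, of "right 1 p"] up k_pos by (simp add: below_def)
    then have "black m ?I (right 1 p)"
      using black_path_ideal[of "right 1 p"] strip up k_pos by simp
    then show ?thesis
      using psi_next_up[of 1 k m ?I p] r_black up strip(2) k_pos by simp
  next
    case down
    then show ?thesis
      using psi_next_down[of k m ?I p] not_black r_black strip(2) by simp
  next
    case (right l)
    \<comment> \<open>Shorter right steps and \<open>up k p\<close> all have \<open>v\<close>
      smaller than at \<open>r\<close>.\<close>
    then show ?thesis
      using psi_next_right[of l k m ?I p] not_black r_black strip(2) by simp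
  qed
  moreover have "psi_from m k ?I r = r # suf" using Cons.IH[of "pre @ [p]" r] Cons.prems by simp
  ultimately show ?case by (simp add: psi_from.simps[of m k _ p])
qed

lemma psi_path_ideal: "psi m k (path_ideal m k ps) = ps"
  using psi_from_path_ideal[of "[]" "(0, 0)"] path_Cons by (auto simp: psi_def)

end

section \<open>Injectivity and conclusion\<close>

lemma poset_P_strip:
  assumes "p \<in> poset_P (2 * m) (2 * k + 1)"
  shows "visible p" "0 < fst p" "fst p \<le> real m + 1/2"
proof -
  show "visible p" using assms by (rule poset_P_visible)
  have "0 < fst p \<and> fst p \<le> real m + 1/2"
  proof (cases "0 \<le> snd p")
    case True
    then have "1 \<le> vcoord k p" "ucoord k p \<le> real m"
      using poset_P_nonneg[OF assms] unfolding mem_poset_L by blast+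
    with coord_diff_nonneg[OF True, of k] show ?thesis unfolding fst_eq_coords[of p k] by simp
  next
    case False
    then have "1 \<le> ucoord k p" "vcoord k p \<le> real m + real k"
      using poset_P_neg[OF assms] unfolding mem_poset_R by simp_all
    with coord_diff_neg[of p k] False show ?thesis unfolding fst_eq_coords[of p k] by simp
  qed
  then show "0 < fst p" "fst p \<le> real m + 1/2" by blast+
qed

text \<open>The whole poset lies in the strip and avoids the origin, so colours, and hence the path,
  decide membership in the ideal.\<close>

lemma psi_subset:
  assumes "I \<in> J (2 * m) (2 * k + 1)" "I' \<in> J (2 * m) (2 * k + 1)" "k > 0"
    and "psi m k I = psi m k I'"
  shows "I \<subseteq> I'"
proof
  fix q assume "q \<in> I"
  then have "q \<in> poset_P (2 * m) (2 * k + 1)" using J_subset assms(1) by blast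
  note q = poset_P_strip[OF this]
  then have "q \<noteq> (0, 0)" by auto
  then have "black m I q \<longleftrightarrow> black m I' q"
    using black_iff_below_psi[OF assms(1,3)] black_iff_below_psi[OF assms(2,3)] assms(4) by simp
  with q \<open>q \<in> I\<close> show "q \<in> I'" by (auto simp: black_def split: if_splits)
qed

text \<open>Positivity of \<open>k\<close> is assumed because \<open>psi_0_not_bij\<close> refutes
  the claim for \<open>k = 0\<close>.\<close>

theorem theorem2p25:
  fixes m k :: nat
  assumes "m > 0" and "k > 0"
  shows "bij_betw (psi m k) (J (2 * m) (2 * k + 1)) (Q' m k)"
proof (rule bij_betw_imageI)
  show "inj_on (psi m k) (J (2 * m) (2 * k + 1))"
    using psi_subset assms(2) by (intro inj_onI subset_antisym) metis+
  have "ps \<in> psi m k ` J (2 * m) (2 * k + 1)" if "ps \<in> Q' m k" for ps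
  proof -
    interpret Q'_path m k ps by standard (use assms that in auto)
    show ?thesis using psi_path_ideal path_ideal_mem_J by (metis image_eqI)
  qed
  then show "psi m k ` J (2 * m) (2 * k + 1) = Q' m k"
    using psi_mem_Q' assms(2) by blast
qed

end
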